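(* Let $X=\mathbb{N}$ or $X=\mathbb{Z}$, and let $\mathbf{l}=\mathbf{l}(X)$ be any one of the spaces $l_\infty$, $l_1$, $l_0$ of real functions on $X$. Let $B=(b_{ij})_{i,j\in X}$ be a matrix with entries in $\mathbb{R}\cup\{-\infty\}$ satisfying condition (C). Then $B$ is $\mathbf{l}$-strongly regular if and only if $B$ is $\mathbf{l}$-similar to a strongly normal matrix.
   Context: Spaces: $l_\infty$, $l_1$, $l_0$ denote the spaces of real functions $s=(s_i)_{i\in X}$ with, respectively, $\sup_i|s_i|<\infty$; $\sup_n\sum_{|i|\le n}|s_i|<\infty$; the finite limit $\lim_{|n|\to\infty}s_n$ exists. Condition (C): for any $i$ there is $j$ with $b_{ij}\ne-\infty$; for any $j$ there is $i$ with $b_{ij}\neq-\infty$; and $b_{ij}\to-\infty$ as $|i-j|\to\infty$. All matrices considered have entries in $\mathbb{R}\cup\{-\infty\}$ and satisfy (C). Operators: $(Bf)_i=\sup_j\{b_{ij}-f_j\}$ and $(B^Tg)_j=\sup_i\{b_{ij}-g_i\}$. $\mathbf{l}$-strong regularity: $B$ is $\mathbf{l}$-strongly regular if there exists $g\in\mathbf{l}$ such that (i) $f:=B^Tg\in\mathbf{l}$, (ii) $f$ is the unique solution in $\mathbb{R}^X$ of the equation $Bf=g$ (with $g$ given), and (iii) $g$ is the unique solution in $\mathbb{R}^X$ of the equation $f=B^Tg$ (with $f$ given). Locally bounded bijection: a bijection $F:X\to X$ with $\sup_n|F(n)-n|<\infty$. $\mathbf{l}$-similarity: matrices $B$ and $C$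 are (locally bounded) $\mathbf{l}$-similar if there exist two locally bounded bijections $H,K:X\to X$ and two vectors $\phi,\psi\in\mathbf{l}(X)$ such that $c_{ij}=b_{H(i)K(j)}-\phi_i-\psi_j$ for all $i,j\in X$. Strongly normal: $b_{ii}=0$ for all $i$ and all non-diagonal entries are negative ($-\infty$ allowed). *)

theory Defs
  imports "HOL-Analysis.Analysis"
begin

text \<open>
  The definitions are polymorphic in the index type, which is instantiated to \<^typ>\<open>nat\<close> or
  \<^typ>\<open>int\<close>. The following is the absolute value of the difference; on \<^typ>\<open>nat\<close>,
  where subtraction is truncated and there is no absolute value, it is still correct.
\<close>

definition absdiff :: "'a::linordered_semidom \<Rightarrow> 'a \<Rightarrow> 'a" where
  "absdiff i j = max i j - min i j"

lemma absdiff_nat: "int (absdiff m n) = \<bar>int m - int n\<bar>"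
  by (auto simp: absdiff_def max_def min_def)

lemma absdiff_int: "absdiff (i::int) j = \<bar>i - j\<bar>"
  by (auto simp: absdiff_def max_def min_def)

type_synonym 'a mat = "'a \<Rightarrow> 'a \<Rightarrow> ereal"

definition l_infty :: "('a \<Rightarrow> real) set" where
  "l_infty = {s. bdd_above (range (\<lambda>i. \<bar>s i\<bar>))}"

definition l_one :: "('a::linordered_semidom \<Rightarrow> real) set" where
  "l_one = {s. bdd_above (range (\<lambda>n::nat. \<Sum>i | absdiff i 0 \<le> of_nat n. \<bar>s i\<bar>))}"

text \<open>For \<^typ>\<open>int\<close> the limit is the same at both ends.\<close>

definition l_zero :: "('a::linordered_semidom \<Rightarrow> real) set" where
  "l_zero = {s. \<exists>L. (s \<longlongrightarrow> L) (filtercomap (\<lambda>i. absdiff i 0) at_top)}"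

definition maxplus_mat :: "'a mat \<Rightarrow> bool" where
  "maxplus_mat B \<longleftrightarrow> (\<forall>i j. B i j \<noteq> \<infinity>)"

text \<open>The limit in the last conjunct is uniform in the pair of indices.\<close>

definition cond_C :: "'a::linordered_semidom mat \<Rightarrow> bool" where
  "cond_C B \<longleftrightarrow>
     (\<forall>i. \<exists>j. B i j \<noteq> -\<infinity>) \<and>
     (\<forall>j. \<exists>i. B i j \<noteq> -\<infinity>) \<and>
     ((\<lambda>(i, j). B i j) \<longlongrightarrow> -\<infinity>) (filtercomap (\<lambda>(i, j). absdiff i j) at_top)"

text \<open>
  For a real argument the supremum may be infinite, so the operators take values in
  \<^typ>\<open>ereal\<close>; equations with a real right-hand side are stated after embedding it.
\<close>

definition mat_op :: "'a mat \<Rightarrow> ('a \<Rightarrow> real) \<Rightarrow> 'a \<Rightarrow> ereal" where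
  "mat_op B f = (\<lambda>i. SUP j. B i j - ereal (f j))"

definition mat_op_T :: "'a mat \<Rightarrow> ('a \<Rightarrow> real) \<Rightarrow> 'a \<Rightarrow> ereal" where
  "mat_op_T B g = (\<lambda>j. SUP i. B i j - ereal (g i))"

text \<open>
  The first conjunct says that \<open>mat_op_T B g\<close> is the real function \<open>f\<close>; each equivalence
  says that the function on its right is the unique real solution of the equation on its left.
\<close>

definition strongly_regular :: "('a \<Rightarrow> real) set \<Rightarrow> 'a mat \<Rightarrow> bool" where
  "strongly_regular l B \<longleftrightarrow>
     (\<exists>g\<in>l. \<exists>f\<in>l.
        mat_op_T B g = ereal \<circ> f \<and>
        (\<forall>f'. mat_op B f' = ereal \<circ> g \<longleftrightarrow> f' = f) \<and>
        (\<forall>g'. mat_op_T B g' = ereal \<circ> f \<longleftrightarrow> g' = g))"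

definition locally_bounded_bij :: "('a::linordered_semidom \<Rightarrow> 'a) \<Rightarrow> bool" where
  "locally_bounded_bij F \<longleftrightarrow> bij F \<and> bdd_above (range (\<lambda>n. absdiff (F n) n))"

definition similar_mat :: "('a::linordered_semidom \<Rightarrow> real) set \<Rightarrow> 'a mat \<Rightarrow> 'a mat \<Rightarrow> bool" where
  "similar_mat l B C \<longleftrightarrow>
     (\<exists>H K. locally_bounded_bij H \<and> locally_bounded_bij K \<and>
       (\<exists>\<phi>\<in>l. \<exists>\<psi>\<in>l. \<forall>i j. C i j = B (H i) (K j) - ereal (\<phi> i) - ereal (\<psi> j)))"

definition strongly_normal :: "'a mat \<Rightarrow> bool" where
  "strongly_normal B \<longleftrightarrow> (\<forall>i. B i i = 0) \<and> (\<forall>i j. i \<noteq> j \<longrightarrow> B i j < 0)"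

end

theory Submission
  imports Defs
begin

text \<open>
  The substitution \<open>D i j = B i j - g i - f j\<close> turns the equations for \<open>B\<close> with right-hand
  sides \<open>g\<close> and \<open>f\<close> into the equations for \<open>D\<close> and its transpose with right-hand side \<open>0\<close>,
  with the zero vector as the solution in question, and the similarities of the theorem are such
  substitutions combined with permutations of rows and columns (\<open>regular_pair_similar\<close>).
  It remains to see when \<open>0\<close> is the only solution \<open>h\<close> of the equations
  \<open>(SUP j. D i j - h j) = 0\<close> and of those of the transpose. When \<open>h \<ge> 0\<close>, condition (C)
  makes the suprema attained, so that everything is decided by the set of zero entries of \<open>D\<close>.

  Suppose that \<open>0\<close> is the only solution of both systems. Then \<open>D \<le> 0\<close>, and every column \<open>j\<close> has a row whose
  only zero is in that column: otherwise raising \<open>h j\<close> from \<open>0\<close> to \<open>1\<close> gives a second solution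
  (\<open>unique_zero_solution_imp_row_with_single_zero\<close>). The same holds for the transpose. The two
  choice functions so obtained are inverse to each other, and the zeros of \<open>D\<close> are exactly the
  entries \<open>(i, K i)\<close> for a bijection \<open>K\<close>; moving column \<open>K i\<close> to place \<open>i\<close> gives a strongly
  normal matrix. As \<open>D\<close> is negative far from the diagonal, \<open>K\<close> is locally bounded.
  Conversely, in a strongly normal matrix the diagonal forces \<open>h \<ge> 0\<close>; the supremum in row \<open>i\<close>
  is then attained, which is possible only at the diagonal entry and with \<open>h i = 0\<close>.

  Two properties of the three sequence spaces enter: their elements are bounded, so
  the substitution preserves condition (C), and they are closed under composition with locally
  bounded bijections, so \<open>g\<close> and \<open>f\<close> stay in the space when rows and columns are permuted.
\<close>

section \<open>Distance in the index set\<close>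

text \<open>
  What \<^typ>\<open>nat\<close> and \<^typ>\<open>int\<close> have in common for this proof: discreteness, in a form that
  also implies the Archimedean property. It allows a single proof for both index sets.
\<close>

class locally_finite_semidom = linordered_semidom +
  assumes finite_closed_interval: "finite {a..b}"

instance nat :: locally_finite_semidom
  by standard simp

instance int :: locally_finite_semidom
  by standard simp

lemma absdiff_commute: "absdiff i j = absdiff j i"
  by (simp add: absdiff_def max.commute min.commute)

lemma min_add_absdiff: "min i j + absdiff i j = max i j"
  unfolding absdiff_def by (rule le_add_diff_inverse) (simp add: min_le_iff_disj)

lemma absdiff_nonneg: "0 \<le> absdiff i j"
  using add_le_cancel_left[of "min i j" 0 "absdiff i j"]
  by (simp add: min_add_absdiff min_le_iff_disj)

text \<open>
  This form avoids subtraction, which is truncated on \<^typ>\<open>nat\<close>.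
\<close>

lemma absdiff_le_iff: "absdiff i j \<le> c \<longleftrightarrow> i \<le> j + c \<and> j \<le> i + c"
proof -
  have "absdiff i j \<le> c \<longleftrightarrow> max i j \<le> min i j + c"
    using add_le_cancel_left[of "min i j" "absdiff i j" c] by (simp add: min_add_absdiff)
  also have "max i j \<le> min i j + c \<longleftrightarrow> i \<le> j + c \<and> j \<le> i + c"
    using absdiff_nonneg[of i j] calculation
    by (smt (verit) add_increasing2 dual_order.trans linear max_def min_def)
  finally show ?thesis .
qed

lemma absdiff_triangle: "absdiff i k \<le> absdiff i j + absdiff j k"
proof -
  have *: "i \<le> j + absdiff i j" "j \<le> i + absdiff i j" for i j :: 'a
    using absdiff_le_iff[of i j "absdiff i j"] by auto
  have "i \<le> k + (absdiff i j + absdiff j k)"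
  proof -
    have "i \<le> (k + absdiff j k) + absdiff i j"
      using *(1)[where i = i and j = j] *(1)[where i = j and j = k] by (meson add_right_mono order_trans)
    then show ?thesis by (simp add: ac_simps)
  qed
  moreover have "k \<le> i + (absdiff i j + absdiff j k)"
  proof -
    have "k \<le> (i + absdiff i j) + absdiff j k"
      using *(2)[where i = i and j = j] *(2)[where i = j and j = k] by (meson add_right_mono order_trans)
    then show ?thesis by (simp add: ac_simps)
  qed
  ultimately show ?thesis by (simp add: absdiff_le_iff)
qed

text \<open>
  The class leaves \<open>i - c\<close> for \<open>c > i\<close> unspecified, so the ball has no uniform description as
  an interval. Instead, each half of it embeds into \<open>{0..c}\<close> by the distance to the centre.
\<close>

lemma finite_absdiff_le: "finite {j :: 'a :: locally_finite_semidom. absdiff i j \<le> c}"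
proof -
  let ?S = "{j. absdiff i j \<le> c}"
  have finite_if_inj: "finite (?S \<inter> A)" if "inj_on (absdiff i) (?S \<inter> A)" for A
    using that
  proof (rule inj_on_finite)
    show "absdiff i ` (?S \<inter> A) \<subseteq> {0..c}"
      by (auto simp: absdiff_nonneg)
  qed (rule finite_closed_interval)
  have "inj_on (absdiff i) (?S \<inter> {i..})"
  proof (rule inj_onI)
    fix j k
    assume "j \<in> ?S \<inter> {i..}" "k \<in> ?S \<inter> {i..}" "absdiff i j = absdiff i k"
    then show "j = k"
      using min_add_absdiff[of i j] min_add_absdiff[of i k]
      by (simp add: min_absorb1 max_absorb2)
  qed
  then have up: "finite (?S \<inter> {i..})"
    by (rule finite_if_inj)
  have "inj_on (absdiff i) (?S \<inter> {..i})"
  proof (rule inj_onI)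
    fix j k
    assume "j \<in> ?S \<inter> {..i}" "k \<in> ?S \<inter> {..i}" "absdiff i j = absdiff i k"
    then have "j + absdiff i k = k + absdiff i k"
      using min_add_absdiff[of i j] min_add_absdiff[of i k]
      by (simp add: min_absorb2 max_absorb1)
    then show "j = k" by simp
  qed
  then have "finite (?S \<inter> {..i})"
    by (rule finite_if_inj)
  moreover have "?S = (?S \<inter> {i..}) \<union> (?S \<inter> {..i})"
    by auto
  ultimately show ?thesis
    using up by (metis finite_Un)
qed

lemma ex_le_of_nat_locally_finite: "\<exists>n. (x :: 'a :: locally_finite_semidom) \<le> of_nat n"
proof (rule ccontr)
  assume "\<not> ?thesis"
  then have "of_nat n \<le> x" for n
    by (meson linear)
  then have "range of_nat \<subseteq> {0..x}"
    by auto
  then have "finite (range (of_nat :: nat \<Rightarrow> 'a))"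
    using finite_closed_interval finite_subset by blast
  then show False
    using range_inj_infinite[OF inj_of_nat] by blast
qed

section \<open>Locally bounded bijections\<close>

lemma locally_bounded_bijE:
  assumes "locally_bounded_bij F"
  obtains M where "bij F" "\<And>n. absdiff (F n) n \<le> M"
  using assms unfolding locally_bounded_bij_def bdd_above_def by auto

lemma locally_bounded_bijI:
  assumes "bij F" "\<And>n. absdiff (F n) n \<le> M"
  shows "locally_bounded_bij F"
  using assms unfolding locally_bounded_bij_def bdd_above_def by auto

lemma locally_bounded_bij_id: "locally_bounded_bij (\<lambda>n. n)"
  by (rule locally_bounded_bijI[where M = 0]) (auto simp: absdiff_le_iff bij_id[unfolded id_def])

lemma locally_bounded_bij_inv:
  assumes "locally_bounded_bij F"
  shows "locally_bounded_bij (inv F)"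
proof -
  obtain M where F: "bij F" "\<And>n. absdiff (F n) n \<le> M"
    using assms by (rule locally_bounded_bijE) blast
  have "absdiff (inv F n) n \<le> M" for n
    using F(2)[of "inv F n"] F(1) by (simp add: bij_is_surj surj_f_inv_f absdiff_commute)
  then show ?thesis
    using F(1) bij_imp_bij_inv locally_bounded_bijI by metis
qed

section \<open>The sequence spaces\<close>

text \<open>
  The common properties through which the three spaces enter the proof.
\<close>

definition bounded_rearrangement_space :: "('a::linordered_semidom \<Rightarrow> real) set \<Rightarrow> bool" where
  "bounded_rearrangement_space l \<longleftrightarrow>
     l \<subseteq> l_infty \<and> (\<forall>s\<in>l. \<forall>F. locally_bounded_bij F \<longrightarrow> (\<lambda>i. s (F i)) \<in> l)"

lemma l_inftyI: "(\<And>i. \<bar>s i\<bar> \<le> c) \<Longrightarrow> s \<in> l_infty"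
  unfolding l_infty_def bdd_above_def by auto

lemma l_inftyE:
  assumes "s \<in> l_infty" obtains c where "\<And>i. \<bar>s i\<bar> \<le> c"
  using assms unfolding l_infty_def bdd_above_def by auto

lemma bounded_rearrangement_l_infty: "bounded_rearrangement_space l_infty"
  unfolding bounded_rearrangement_space_def l_infty_def bdd_above_def by fastforce

text \<open>
  Bounded sums over balls bound the sums over all finite sets by the same constant, since every
  finite set lies in some ball; in the latter form the property is invariant under any
  injective reindexing.
\<close>

lemma bounded_rearrangement_l_one:
  "bounded_rearrangement_space (l_one :: ('a::locally_finite_semidom \<Rightarrow> real) set)"
  unfolding bounded_rearrangement_space_def
proof (intro conjI subsetI ballI allI impI)
  let ?ball = "\<lambda>n. {i :: 'a. absdiff i 0 \<le> of_nat n}"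
  have fin: "finite (?ball n)" for n
    using finite_absdiff_le[of 0 "of_nat n"] by (simp add: absdiff_commute)
  fix s :: "'a \<Rightarrow> real"
  assume "s \<in> l_one"
  then obtain c where c: "\<And>n. (\<Sum>i\<in>?ball n. \<bar>s i\<bar>) \<le> c"
    unfolding l_one_def bdd_above_def by auto
  have finsum: "(\<Sum>i\<in>A. \<bar>s i\<bar>) \<le> c" if "finite A" for A
  proof -
    have "\<exists>n. \<forall>i\<in>A. absdiff i 0 \<le> of_nat n"
      using that
    proof induction
      case (insert x A)
      then obtain n where n: "\<forall>i\<in>A. absdiff i 0 \<le> of_nat n" by auto
      obtain m where m: "absdiff x 0 \<le> of_nat m"
        using ex_le_of_nat_locally_finite by blast
      have "(of_nat n :: 'a) \<le> of_nat (max n m)" "(of_nat m :: 'a) \<le> of_nat (max n m)"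
        by (simp_all del: of_nat_max)
      with n m have "\<forall>i\<in>insert x A. absdiff i 0 \<le> of_nat (max n m)"
        by (metis insert_iff order_trans)
      then show ?case by blast
    qed simp
    then obtain n where "A \<subseteq> ?ball n" by auto
    then have "(\<Sum>i\<in>A. \<bar>s i\<bar>) \<le> (\<Sum>i\<in>?ball n. \<bar>s i\<bar>)"
      using fin by (intro sum_mono2) auto
    with c[of n] show ?thesis by linarith
  qed
  show "s \<in> l_infty"
    using finsum[of "{_}"] by (intro l_inftyI[of _ c]) simp
  fix F :: "'a \<Rightarrow> 'a"
  assume "locally_bounded_bij F"
  then have "inj F"
    by (simp add: locally_bounded_bij_def bij_is_inj)
  then have "(\<Sum>i\<in>?ball n. \<bar>s (F i)\<bar>) \<le> c" for n
    using finsum[of "F ` ?ball n"] fin[of n]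
    by (simp add: sum.reindex inj_on_subset)
  then show "(\<lambda>i. s (F i)) \<in> l_one"
    unfolding l_one_def bdd_above_def by auto
qed

text \<open>
  Only finitely many terms can be far from the limit, which gives boundedness. A locally bounded
  map moves indices by at most a constant, so it tends to infinity in absolute value along with
  its argument.
\<close>

lemma bounded_rearrangement_l_zero:
  "bounded_rearrangement_space (l_zero :: ('a::locally_finite_semidom \<Rightarrow> real) set)"
  unfolding bounded_rearrangement_space_def
proof (intro conjI subsetI ballI allI impI)
  let ?inf = "filtercomap (\<lambda>i :: 'a. absdiff i 0) at_top"
  fix s :: "'a \<Rightarrow> real"
  assume "s \<in> l_zero"
  then obtain L where L: "(s \<longlongrightarrow> L) ?inf"
    unfolding l_zero_def by auto
  show "s \<in> l_infty"
  proof -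
    have "eventually (\<lambda>i. dist (s i) L < 1) ?inf"
      using L by (rule tendstoD) simp
    then obtain N where N: "\<And>i. N \<le> absdiff i 0 \<Longrightarrow> dist (s i) L < 1"
      unfolding eventually_filtercomap_at_top_linorder by blast
    have "finite {i. absdiff i 0 \<le> N}"
      using finite_absdiff_le[of 0 N] by (simp add: absdiff_commute)
    then have bdd: "bdd_above ((\<lambda>i. \<bar>s i\<bar>) ` {i. absdiff i 0 \<le> N})"
      by simp
    then obtain c where c: "\<And>i. absdiff i 0 \<le> N \<Longrightarrow> \<bar>s i\<bar> \<le> c"
      unfolding bdd_above_def by auto
    show ?thesis
    proof (rule l_inftyI)
      fix i
      show "\<bar>s i\<bar> \<le> max c (\<bar>L\<bar> + 1)"
        using linear[of N "absdiff i 0"]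
      proof
        assume "N \<le> absdiff i 0"
        then show ?thesis using N[of i] by (simp add: dist_real_def)
      next
        assume "absdiff i 0 \<le> N"
        then show ?thesis using c[of i] by simp
      qed
    qed
  qed
  fix F :: "'a \<Rightarrow> 'a"
  assume "locally_bounded_bij F"
  then obtain M where M: "\<And>n. absdiff (F n) n \<le> M"
    by (rule locally_bounded_bijE) blast
  have "filterlim F ?inf ?inf"
    unfolding filterlim_iff
  proof (intro allI impI)
    fix P
    assume "eventually P ?inf"
    then obtain N where N: "\<And>i. N \<le> absdiff i 0 \<Longrightarrow> P i"
      unfolding eventually_filtercomap_at_top_linorder by blast
    have "P (F i)" if "M + N \<le> absdiff i 0" for i
    proof (rule N)
      have "M + N \<le> M + absdiff (F i) 0"
        using that absdiff_triangle[of i 0 "F i"] M[of i]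
        by (metis absdiff_commute add_right_mono order_trans)
      then show "N \<le> absdiff (F i) 0" by simp
    qed
    then show "eventually (\<lambda>i. P (F i)) ?inf"
      unfolding eventually_filtercomap_at_top_linorder by blast
  qed
  then have "((\<lambda>i. s (F i)) \<longlongrightarrow> L) ?inf"
    using L by (rule filterlim_compose[rotated])
  then show "(\<lambda>i. s (F i)) \<in> l_zero"
    unfolding l_zero_def by auto
qed

section \<open>Condition (C) under similarity\<close>

lemma cond_C_decay_iff:
  "((\<lambda>(i, j). B i j) \<longlongrightarrow> -\<infinity>) (filtercomap (\<lambda>(i, j). absdiff i j) at_top) \<longleftrightarrow>
     (\<forall>r. \<exists>N. \<forall>i j. N \<le> absdiff i j \<longrightarrow> B i j < ereal r)"
  unfolding tendsto_MInfty eventually_filtercomap_at_top_linorder by auto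

lemma cond_C_decay:
  assumes "cond_C B"
  obtains N where "\<And>i j. N \<le> absdiff i j \<Longrightarrow> B i j < ereal r"
  using assms unfolding cond_C_def cond_C_decay_iff by metis

lemma cond_C_transpose: "cond_C B \<Longrightarrow> cond_C (\<lambda>i j. B j i)"
  unfolding cond_C_def cond_C_decay_iff by (metis absdiff_commute)

text \<open>
  Uniform decay survives because \<open>H\<close> and \<open>K\<close> change the distance to the diagonal by at most
  the constant \<open>M + M'\<close> and \<open>\<phi>\<close> and \<open>\<psi>\<close> change the entries by at most \<open>c + d\<close>.
\<close>

lemma cond_C_similar:
  fixes B :: "'a::linordered_semidom mat"
  assumes "cond_C B" "locally_bounded_bij H" "locally_bounded_bij K"
    and "\<phi> \<in> l_infty" "\<psi> \<in> l_infty"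
  shows "cond_C (\<lambda>i j. B (H i) (K j) - ereal (\<phi> i) - ereal (\<psi> j))"
proof -
  obtain M where H: "bij H" and M: "\<And>n. absdiff (H n) n \<le> M"
    using assms(2) by (rule locally_bounded_bijE) blast
  obtain M' where K: "bij K" and M': "\<And>n. absdiff (K n) n \<le> M'"
    using assms(3) by (rule locally_bounded_bijE) blast
  obtain c d where c: "\<And>i. \<bar>\<phi> i\<bar> \<le> c" and d: "\<And>i. \<bar>\<psi> i\<bar> \<le> d"
    using assms(4,5) l_inftyE by metis
  have "\<exists>N. \<forall>i j. N \<le> absdiff i j \<longrightarrow> B (H i) (K j) - ereal (\<phi> i) - ereal (\<psi> j) < ereal r" for r
  proof -
    obtain N where N: "\<And>i j. N \<le> absdiff i j \<Longrightarrow> B i j < ereal (r - c - d)"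
      using assms(1) by (rule cond_C_decay) blast
    have "B (H i) (K j) - ereal (\<phi> i) - ereal (\<psi> j) < ereal r"
      if "(M + M') + N \<le> absdiff i j" for i j
    proof -
      have "absdiff i j \<le> absdiff i (H i) + (absdiff (H i) (K j) + absdiff (K j) j)"
        using absdiff_triangle[of i j "H i"] absdiff_triangle[of "H i" j "K j"]
        by (meson add_left_mono order_trans)
      also have "\<dots> \<le> M + (absdiff (H i) (K j) + M')"
        using M[of i] M'[of j] by (intro add_mono) (auto simp: absdiff_commute)
      finally have "(M + M') + N \<le> (M + M') + absdiff (H i) (K j)"
        using that order_trans by (fastforce simp: ac_simps)
      then have "B (H i) (K j) < ereal (r - c - d)"
        using N by simp
      then show ?thesis
        using c[of i] d[of j] by (cases "B (H i) (K j)") auto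
    qed
    then show ?thesis by blast
  qed
  moreover have "\<exists>i. B (H i) (K j) - ereal (\<phi> i) - ereal (\<psi> j) \<noteq> -\<infinity>" for j
  proof -
    obtain i where "B i (K j) \<noteq> -\<infinity>"
      using assms(1) unfolding cond_C_def by blast
    then have "B (H (inv H i)) (K j) - ereal (\<phi> (inv H i)) - ereal (\<psi> j) \<noteq> -\<infinity>"
      using H by (cases "B i (K j)") (auto simp: bij_is_surj surj_f_inv_f)
    then show ?thesis by blast
  qed
  moreover have "\<exists>j. B (H i) (K j) - ereal (\<phi> i) - ereal (\<psi> j) \<noteq> -\<infinity>" for i
  proof -
    obtain j where "B (H i) j \<noteq> -\<infinity>"
      using assms(1) unfolding cond_C_def by blast
    then have "B (H i) (K (inv K j)) - ereal (\<phi> i) - ereal (\<psi> (inv K j)) \<noteq> -\<infinity>"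
      using K by (cases "B (H i) j") (auto simp: bij_is_surj surj_f_inv_f)
    then show ?thesis by blast
  qed
  ultimately show ?thesis
    unfolding cond_C_def cond_C_decay_iff by blast
qed

text \<open>
  The part of condition (C) that makes suprema attained; \<open>-1\<close> could be any negative number.
\<close>

definition row_finite :: "('a \<Rightarrow> 'b \<Rightarrow> ereal) \<Rightarrow> bool" where
  "row_finite D \<longleftrightarrow> (\<forall>i. finite {j. -1 < D i j})"

lemma cond_C_imp_row_finite:
  fixes B :: "'a::locally_finite_semidom mat"
  assumes "cond_C B"
  shows "row_finite B"
  unfolding row_finite_def
proof
  fix i
  obtain N where N: "\<And>i j. N \<le> absdiff i j \<Longrightarrow> B i j < ereal (-1)"
    using assms by (rule cond_C_decay) blast
  have "{j. -1 < B i j} \<subseteq> {j. absdiff i j \<le> N}"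
    using N[of i] by (auto simp: one_ereal_def) (meson less_le_not_le nle_le)
  then show "finite {j. -1 < B i j}"
    using finite_absdiff_le finite_subset by blast
qed

section \<open>The dual pair of zero vectors\<close>

text \<open>
  Strong regularity with its witnesses made explicit, and with the transpose in place of the second
  operator, so that each fact about rows also yields the one about columns.
\<close>

definition regular_pair :: "'a mat \<Rightarrow> ('a \<Rightarrow> real) \<Rightarrow> ('a \<Rightarrow> real) \<Rightarrow> bool" where
  "regular_pair B g f \<longleftrightarrow>
     (\<forall>f'. mat_op B f' = ereal \<circ> g \<longleftrightarrow> f' = f) \<and>
     (\<forall>g'. mat_op (\<lambda>i j. B j i) g' = ereal \<circ> f \<longleftrightarrow> g' = g)"

text \<open>
  The requirement that \<open>B\<^sup>T g\<close> equals \<open>f\<close> is the case \<open>g' = g\<close> of the second equivalence.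
\<close>

lemma strongly_regular_iff_regular_pair:
  "strongly_regular l B \<longleftrightarrow> (\<exists>g\<in>l. \<exists>f\<in>l. regular_pair B g f)"
proof -
  have "mat_op_T B = mat_op (\<lambda>i j. B j i)"
    by (simp add: fun_eq_iff mat_op_def mat_op_T_def)
  then show ?thesis
    unfolding strongly_regular_def regular_pair_def by auto
qed

lemma bij_all_iff:
  assumes "bij H"
  shows "(\<forall>i. P (H i) i) \<longleftrightarrow> (\<forall>i. P i (inv H i))"
proof
  assume "\<forall>i. P (H i) i"
  then have "P (H (inv H i)) (inv H i)" for i by blast
  then show "\<forall>i. P i (inv H i)"
    using assms by (simp add: bij_is_surj surj_f_inv_f)
next
  assume "\<forall>i. P i (inv H i)"
  then have "P (H i) (inv H (H i))" for i by blast
  then show "\<forall>i. P (H i) i"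
    using assms by (simp add: bij_is_inj)
qed

lemma ereal_minus_eq_0_iff: "x - ereal r = 0 \<longleftrightarrow> x = ereal r"
  by (cases x) auto

text \<open>
  A change of variables \<open>h \<mapsto> (h + \<psi>) \<circ> inv K\<close> in the supremum. The real numbers
  \<open>\<phi> i\<close> can be taken out of it.
\<close>

lemma mat_op_similar:
  assumes "bij H" "bij K"
  shows "mat_op (\<lambda>i j. B (H i) (K j) - ereal (\<phi> i) - ereal (\<psi> j)) h = ereal \<circ> (\<lambda>_. 0) \<longleftrightarrow>
         mat_op B (\<lambda>j. h (inv K j) + \<psi> (inv K j)) = ereal \<circ> (\<lambda>i. \<phi> (inv H i))"
proof -
  let ?f = "\<lambda>j. h (inv K j) + \<psi> (inv K j)"
  have shift: "mat_op (\<lambda>i j. B (H i) (K j) - ereal (\<phi> i) - ereal (\<psi> j)) h i =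
               mat_op B ?f (H i) - ereal (\<phi> i)" for i
  proof -
    have "mat_op B ?f (H i) = (SUP j\<in>range K. B (H i) j - ereal (?f j))"
      using bij_is_surj[OF assms(2)] by (simp only: mat_op_def)
    also have "\<dots> = (SUP j. B (H i) (K j) - ereal (?f (K j)))"
      by (simp only: image_image)
    also have "\<dots> = (SUP j. B (H i) (K j) - ereal (h j + \<psi> j))"
      using assms(2) by (simp add: bij_is_inj inv_f_f)
    also have "\<dots> - ereal (\<phi> i) = (SUP j. B (H i) (K j) - ereal (h j + \<psi> j) - ereal (\<phi> i))"
      by (subst SUP_ereal_minus_left) auto
    also have "\<dots> = (SUP j. B (H i) (K j) - ereal (\<phi> i) - ereal (\<psi> j) - ereal (h j))"
    proof (rule SUP_cong[OF refl])
      fix j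
      show "B (H i) (K j) - ereal (h j + \<psi> j) - ereal (\<phi> i) =
            B (H i) (K j) - ereal (\<phi> i) - ereal (\<psi> j) - ereal (h j)"
        by (cases "B (H i) (K j)") auto
    qed
    finally show ?thesis
      by (simp add: mat_op_def)
  qed
  have "(\<forall>i. mat_op B ?f (H i) = ereal (\<phi> i)) \<longleftrightarrow> (\<forall>i. mat_op B ?f i = ereal (\<phi> (inv H i)))"
    by (rule bij_all_iff[OF assms(1), of "\<lambda>x i. mat_op B ?f x = ereal (\<phi> i)"])
  then show ?thesis
    by (simp add: fun_eq_iff shift ereal_minus_eq_0_iff flip: zero_ereal_def)
qed

text \<open>
  The change of variables of \<open>mat_op_similar\<close> is a bijection between real vectors and sends
  \<open>0\<close> to \<open>\<psi> \<circ> inv K\<close>, so unique solvability is transported; exchanging the roles of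
  \<open>(H, \<phi>)\<close> and \<open>(K, \<psi>)\<close> gives the same for the transpose.
\<close>

lemma regular_pair_similar:
  fixes B :: "'a mat" and H K :: "'a \<Rightarrow> 'a"
  assumes "bij H" "bij K"
  shows "regular_pair (\<lambda>i j. B (H i) (K j) - ereal (\<phi> i) - ereal (\<psi> j)) (\<lambda>_. 0) (\<lambda>_. 0) \<longleftrightarrow>
         regular_pair B (\<lambda>i. \<phi> (inv H i)) (\<lambda>j. \<psi> (inv K j))"
proof -
  have unique: "(\<forall>h. mat_op (\<lambda>i j. B (H i) (K j) - ereal (\<phi> i) - ereal (\<psi> j)) h = ereal \<circ> (\<lambda>_. 0)
                   \<longleftrightarrow> h = (\<lambda>_. 0)) \<longleftrightarrow>
                (\<forall>f. mat_op B f = ereal \<circ> (\<lambda>i. \<phi> (inv H i)) \<longleftrightarrow> f = (\<lambda>j. \<psi> (inv K j)))"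
    if H: "bij H" and K: "bij K"
    for B :: "'a mat" and H K :: "'a \<Rightarrow> 'a" and \<phi> \<psi> :: "'a \<Rightarrow> real"
  proof -
    define T where "T h = (\<lambda>j. h (inv K j) + \<psi> (inv K j))" for h :: "'a \<Rightarrow> real"
    have inv_T: "T (\<lambda>j. f (K j) - \<psi> j) = f" for f
      using K by (simp add: T_def bij_is_surj surj_f_inv_f)
    have zero_T: "T h = (\<lambda>j. \<psi> (inv K j)) \<longleftrightarrow> h = (\<lambda>_. 0)" for h
      using bij_all_iff[OF K, of "\<lambda>_ j. h j = 0"] by (simp add: T_def fun_eq_iff)
    have surj_T: "(\<forall>f. Q f) \<longleftrightarrow> (\<forall>h. Q (T h))" for Q
      using inv_T by metis
    show ?thesis
      unfolding mat_op_similar[OF H K] T_def[symmetric] zero_T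
        surj_T[of "\<lambda>f. mat_op B f = ereal \<circ> (\<lambda>i. \<phi> (inv H i)) \<longleftrightarrow>
                        f = (\<lambda>j. \<psi> (inv K j))"] ..
  qed
  have "(\<lambda>i j. B (H j) (K i) - ereal (\<phi> j) - ereal (\<psi> i)) =
        (\<lambda>i j. B (H j) (K i) - ereal (\<psi> i) - ereal (\<phi> j))"
  proof (intro ext)
    fix i j
    show "B (H j) (K i) - ereal (\<phi> j) - ereal (\<psi> i) = B (H j) (K i) - ereal (\<psi> i) - ereal (\<phi> j)"
      by (cases "B (H j) (K i)") auto
  qed
  then show ?thesis
    unfolding regular_pair_def
    using unique[OF assms, of B \<phi> \<psi>] unique[OF assms(2,1), of "\<lambda>i j. B j i" \<psi> \<phi>] by simp
qed

section \<open>Regularity as a combinatorial property of the zero entries\<close>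

text \<open>
  Only finitely many terms compete for a supremum above \<open>-1\<close>, so if all terms are negative, the
  supremum is at most the larger of \<open>-1\<close> and the maximum of those terms.
\<close>

lemma SUP_eq_0_iff_attained:
  fixes x :: "'a \<Rightarrow> ereal"
  assumes "finite {j. -1 < x j}"
  shows "(SUP j. x j) = 0 \<longleftrightarrow> (\<forall>j. x j \<le> 0) \<and> (\<exists>j. x j = 0)"
proof
  assume sup: "(SUP j. x j) = 0"
  then have le: "x j \<le> 0" for j
    by (metis SUP_upper UNIV_I)
  moreover have "\<exists>j. x j = 0"
  proof (rule ccontr)
    assume "\<not> ?thesis"
    with le have neg: "x j < 0" for j
      by (metis order_le_less)
    define m where "m = Max (insert (-1) (x ` {j. -1 < x j}))"
    have "m \<in> insert (-1) (x ` {j. -1 < x j})"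
      unfolding m_def using assms by (intro Max_in) auto
    then have "m < 0" using neg by auto
    moreover have "x j \<le> m" for j
      unfolding m_def using assms
      by (cases "-1 < x j") (auto simp: Max_ge_iff not_less)
    then have "(SUP j. x j) \<le> m" by (rule SUP_least)
    ultimately show False using sup by simp
  qed
  ultimately show "(\<forall>j. x j \<le> 0) \<and> (\<exists>j. x j = 0)" by blast
next
  assume "(\<forall>j. x j \<le> 0) \<and> (\<exists>j. x j = 0)"
  then show "(SUP j. x j) = 0"
    by (metis SUP_least SUP_upper UNIV_I order_antisym)
qed

lemma ereal_minus_le_0_iff: "x - ereal r \<le> 0 \<longleftrightarrow> x \<le> ereal r"
  by (cases x) auto

text \<open>
  Nonnegativity of \<open>h\<close> is what lets the terms \<open>D i j - h j\<close> inherit the finiteness from \<open>D\<close>;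
  for \<open>h\<close> unbounded below the supremum need not be attained.
\<close>

lemma mat_op_eq_0_iff:
  assumes "row_finite D" "\<And>j. 0 \<le> h j"
  shows "mat_op D h = ereal \<circ> (\<lambda>_. 0) \<longleftrightarrow>
         (\<forall>i. (\<forall>j. D i j \<le> ereal (h j)) \<and> (\<exists>j. D i j = ereal (h j)))"
proof -
  have "(SUP j. D i j - ereal (h j)) = 0 \<longleftrightarrow>
        (\<forall>j. D i j \<le> ereal (h j)) \<and> (\<exists>j. D i j = ereal (h j))" for i
  proof -
    have "D i j - ereal (h j) \<le> D i j" for j
      using assms(2)[of j] by (cases "D i j") auto
    then have "{j. -1 < D i j - ereal (h j)} \<subseteq> {j. -1 < D i j}"
      using less_le_trans by blast
    then have "finite {j. -1 < D i j - ereal (h j)}"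
      using assms(1) finite_subset unfolding row_finite_def by blast
    then show ?thesis
      by (subst SUP_eq_0_iff_attained)
         (simp_all add: ereal_minus_le_0_iff ereal_minus_eq_0_iff)
  qed
  then show ?thesis
    by (simp add: mat_op_def fun_eq_iff flip: zero_ereal_def)
qed

text \<open>
  If every row has a zero outside column \<open>j\<close>, then column \<open>j\<close> can be lowered without changing
  any of the suprema, and the solution is not unique.
\<close>

lemma unique_zero_solution_imp_row_with_single_zero:
  assumes "row_finite D"
    and unique: "\<And>h. mat_op D h = ereal \<circ> (\<lambda>_. 0) \<longleftrightarrow> h = (\<lambda>_. 0)"
  shows "\<exists>i. \<forall>k. D i k = 0 \<longleftrightarrow> k = j"
proof (rule ccontr)
  assume none: "\<not> ?thesis"
  have D: "D i k \<le> 0" "\<exists>k. D i k = 0" for i k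
    using unique[of "\<lambda>_. 0"] mat_op_eq_0_iff[OF assms(1), of "\<lambda>_. 0"]
    by (auto simp: zero_ereal_def)
  \<comment> \<open>the second solution\<close>
  define h :: "_ \<Rightarrow> real" where "h k = (if k = j then 1 else 0)" for k
  have "mat_op D h = ereal \<circ> (\<lambda>_. 0)"
  proof (subst mat_op_eq_0_iff[OF assms(1)])
    show "0 \<le> h k" for k by (simp add: h_def)
    show "\<forall>i. (\<forall>k. D i k \<le> ereal (h k)) \<and> (\<exists>k. D i k = ereal (h k))"
    proof (intro allI conjI)
      fix i
      show "D i k \<le> ereal (h k)" for k
        using D(1)[of i k] order_trans[of "D i k" 0 1]
        by (auto simp: h_def simp flip: zero_ereal_def one_ereal_def)
      obtain k where "k \<noteq> j" "D i k = 0"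
        using none D(2)[of i] by metis
      then show "\<exists>k. D i k = ereal (h k)"
        by (intro exI[of _ k]) (simp add: h_def flip: zero_ereal_def)
    qed
  qed
  then have "h = (\<lambda>_. 0)" using unique by blast
  then have "h j = 0" by simp
  then show False by (simp add: h_def)
qed

text \<open>
  Let \<open>R j\<close> be a row whose only zero is in column \<open>j\<close>, and \<open>K i\<close> a column whose only zero is in
  row \<open>i\<close>. The entry \<open>(R j, j)\<close> is zero, and so is \<open>(R j, K (R j))\<close>; as row \<open>R j\<close> has
  just one zero, \<open>K (R j) = j\<close>. By symmetry \<open>R (K i) = i\<close>. So \<open>K\<close> is a bijection, and
  every column is some \<open>K i\<close>, which locates all zeros.
\<close>

lemma regular_pair_0_imp_strongly_normal:
  assumes "row_finite D" "row_finite (\<lambda>i j. D j i)" "regular_pair D (\<lambda>_. 0) (\<lambda>_. 0)"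
  obtains K where "bij K" "strongly_normal (\<lambda>i j. D i (K j))"
proof -
  have uniq: "mat_op D h = ereal \<circ> (\<lambda>_. 0) \<longleftrightarrow> h = (\<lambda>_. 0)"
    "mat_op (\<lambda>i j. D j i) h = ereal \<circ> (\<lambda>_. 0) \<longleftrightarrow> h = (\<lambda>_. 0)" for h
    using assms(3) unfolding regular_pair_def by blast+
  obtain R where R: "\<And>j k. D (R j) k = 0 \<longleftrightarrow> k = j"
    using unique_zero_solution_imp_row_with_single_zero[OF assms(1) uniq(1)] by metis
  obtain K where K: "\<And>i k. D k (K i) = 0 \<longleftrightarrow> k = i"
    using unique_zero_solution_imp_row_with_single_zero[OF assms(2) uniq(2)] by metis
  have "K (R j) = j" "R (K j) = j" for j
    using R K by metis+
  then have "bij K"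
    by (metis bijI')
  moreover have "D i k \<le> 0" for i k
    using uniq(1)[of "\<lambda>_. 0"] mat_op_eq_0_iff[OF assms(1), of "\<lambda>_. 0"]
    by (auto simp: zero_ereal_def)
  then have "strongly_normal (\<lambda>i j. D i (K j))"
    unfolding strongly_normal_def using K by (metis order_le_less)
  ultimately show ?thesis using that by blast
qed

text \<open>
  An arbitrary solution \<open>h\<close> is nonnegative because the diagonal entry \<open>0\<close> takes part in each
  supremum. This brings \<open>mat_op_eq_0_iff\<close> into play: row \<open>i\<close> contains an entry
  \<open>C i j = h j \<ge> 0\<close>, which must be the diagonal one.
\<close>

lemma strongly_normal_imp_regular_pair_0:
  fixes C :: "'a mat"
  assumes "row_finite C" "row_finite (\<lambda>i j. C j i)" "strongly_normal C"
  shows "regular_pair C (\<lambda>_. 0) (\<lambda>_. 0)"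
proof -
  have "mat_op C h = ereal \<circ> (\<lambda>_. 0) \<longleftrightarrow> h = (\<lambda>_. 0)"
    if fin: "row_finite C" and norm: "strongly_normal C" for C :: "'a mat" and h
  proof
    assume sol: "mat_op C h = ereal \<circ> (\<lambda>_. 0)"
    have nonneg: "0 \<le> h i" for i
    proof -
      have "C i i - ereal (h i) \<le> mat_op C h i"
        unfolding mat_op_def by (rule SUP_upper) simp
      then show ?thesis
        using norm sol by (simp add: strongly_normal_def)
    qed
    show "h = (\<lambda>_. 0)"
    proof
      fix i
      obtain j where j: "C i j = ereal (h j)"
        using sol mat_op_eq_0_iff[where h = h, OF fin nonneg] by blast
      then have "\<not> C i j < 0" using nonneg[of j] by simp
      then have "i = j" using norm unfolding strongly_normal_def by blast
      with j norm show "h i = 0" by (simp add: strongly_normal_def)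
    qed
  next
    assume "h = (\<lambda>_. 0)"
    moreover have "C i j \<le> 0" "\<exists>j. C i j = 0" for i j
      using norm unfolding strongly_normal_def by (metis order_le_less)+
    ultimately show "mat_op C h = ereal \<circ> (\<lambda>_. 0)"
      using mat_op_eq_0_iff[OF fin, of h] by (simp flip: zero_ereal_def)
  qed
  moreover have "strongly_normal (\<lambda>i j. C j i)"
    using assms(3) by (auto simp: strongly_normal_def)
  ultimately show ?thesis
    unfolding regular_pair_def using assms by blast
qed

section \<open>Strong regularity and strong normality\<close>

lemma maxplus_mat_similar:
  assumes "maxplus_mat B"
  shows "maxplus_mat (\<lambda>i j. B (H i) (K j) - ereal (\<phi> i) - ereal (\<psi> j))"
  unfolding maxplus_mat_def
proof (intro allI)
  fix i j
  show "B (H i) (K j) - ereal (\<phi> i) - ereal (\<psi> j) \<noteq> \<infinity>"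
    using assms by (cases "B (H i) (K j)") (auto simp: maxplus_mat_def)
qed

text \<open>
  From left to right the similarity has \<open>H i = i\<close>, \<open>\<phi> = g\<close> and \<open>\<psi> = f \<circ> K\<close>; from right to
  left the witnesses for \<open>B\<close> are \<open>\<phi> \<circ> inv H\<close> and \<open>\<psi> \<circ> inv K\<close>.
\<close>

lemma strongly_regular_iff_similar_strongly_normal:
  fixes B :: "'a::locally_finite_semidom mat"
  assumes l: "bounded_rearrangement_space l" and B: "maxplus_mat B" "cond_C B"
  shows "strongly_regular l B \<longleftrightarrow>
         (\<exists>C. maxplus_mat C \<and> cond_C C \<and> strongly_normal C \<and> similar_mat l B C)"
proof
  assume "strongly_regular l B"
  then obtain g f where gf: "g \<in> l" "f \<in> l" "regular_pair B g f"
    unfolding strongly_regular_iff_regular_pair by blast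
  then have bounded: "g \<in> l_infty" "f \<in> l_infty"
    using l unfolding bounded_rearrangement_space_def by blast+
  define D where "D i j = B i j - ereal (g i) - ereal (f j)" for i j
  have D: "cond_C D"
    unfolding D_def
    by (rule cond_C_similar[OF B(2) locally_bounded_bij_id locally_bounded_bij_id bounded])
  then have rows: "row_finite D" and cols: "row_finite (\<lambda>i j. D j i)"
    using cond_C_transpose cond_C_imp_row_finite by blast+
  have "regular_pair D (\<lambda>_. 0) (\<lambda>_. 0)"
    unfolding D_def
    using regular_pair_similar[of "\<lambda>i. i" "\<lambda>j. j" B g f] gf(3)
    by (simp add: bij_id[unfolded id_def] inv_id[unfolded id_def])
  then obtain K where K: "bij K" and normal: "strongly_normal (\<lambda>i j. D i (K j))"
    using regular_pair_0_imp_strongly_normal[OF rows cols] by blast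
  \<comment> \<open>the zeros \<open>(i, K i)\<close> lie in a band around the diagonal\<close>
  obtain N where N: "\<And>i j. N \<le> absdiff i j \<Longrightarrow> D i j < ereal 0"
    using D by (rule cond_C_decay) blast
  have "absdiff (K i) i \<le> N" for i
    using N[of i "K i"] normal unfolding strongly_normal_def
    by (metis absdiff_commute less_irrefl linear zero_ereal_def)
  with K have lbK: "locally_bounded_bij K"
    by (rule locally_bounded_bijI)
  then have fK: "(\<lambda>j. f (K j)) \<in> l"
    using l gf(2) unfolding bounded_rearrangement_space_def by blast
  then have "(\<lambda>j. f (K j)) \<in> l_infty"
    using l unfolding bounded_rearrangement_space_def by blast
  then have "cond_C (\<lambda>i j. D i (K j))"
    unfolding D_def
    by (rule cond_C_similar[OF B(2) locally_bounded_bij_id lbK bounded(1)])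
  moreover have "maxplus_mat (\<lambda>i j. D i (K j))"
    unfolding D_def
    by (rule maxplus_mat_similar[OF B(1), of "\<lambda>i. i"])
  moreover have "similar_mat l B (\<lambda>i j. D i (K j))"
    unfolding similar_mat_def D_def
    by (intro exI[of _ "\<lambda>i. i"] exI[of _ K] conjI bexI[of _ g] bexI[of _ "\<lambda>j. f (K j)"]
        allI refl locally_bounded_bij_id lbK gf(1) fK)
  ultimately show "\<exists>C. maxplus_mat C \<and> cond_C C \<and> strongly_normal C \<and> similar_mat l B C"
    using normal by blast
next
  assume "\<exists>C. maxplus_mat C \<and> cond_C C \<and> strongly_normal C \<and> similar_mat l B C"
  then obtain C where C: "cond_C C" "strongly_normal C" "similar_mat l B C"
    by blast
  from C(3) obtain H K \<phi> \<psi> where lb: "locally_bounded_bij H" "locally_bounded_bij K"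
    and l': "\<phi> \<in> l" "\<psi> \<in> l"
    and entries: "\<forall>i j. C i j = B (H i) (K j) - ereal (\<phi> i) - ereal (\<psi> j)"
    unfolding similar_mat_def by (elim exE conjE bexE) (rule that)
  have C_eq: "C = (\<lambda>i j. B (H i) (K j) - ereal (\<phi> i) - ereal (\<psi> j))"
    by (intro ext) (simp only: entries)
  have "regular_pair C (\<lambda>_. 0) (\<lambda>_. 0)"
    using cond_C_imp_row_finite[OF C(1)] cond_C_imp_row_finite[OF cond_C_transpose[OF C(1)]] C(2)
    by (rule strongly_normal_imp_regular_pair_0)
  then have "regular_pair B (\<lambda>i. \<phi> (inv H i)) (\<lambda>j. \<psi> (inv K j))"
    using lb unfolding C_eq locally_bounded_bij_def by (simp add: regular_pair_similar)
  moreover have "(\<lambda>i. \<phi> (inv H i)) \<in> l" "(\<lambda>j. \<psi> (inv K j)) \<in> l"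
    using l l' lb locally_bounded_bij_inv unfolding bounded_rearrangement_space_def by blast+
  ultimately show "strongly_regular l B"
    unfolding strongly_regular_iff_regular_pair by blast
qed

theorem theorem1p1:
  shows "(\<forall>l \<in> {l_infty, l_one, l_zero :: (nat \<Rightarrow> real) set}. \<forall>B :: nat mat.
            maxplus_mat B \<longrightarrow> cond_C B \<longrightarrow>
            (strongly_regular l B \<longleftrightarrow>
             (\<exists>C. maxplus_mat C \<and> cond_C C \<and> strongly_normal C \<and> similar_mat l B C))) \<and>
         (\<forall>l \<in> {l_infty, l_one, l_zero :: (int \<Rightarrow> real) set}. \<forall>B :: int mat.
            maxplus_mat B \<longrightarrow> cond_C B \<longrightarrow>
            (strongly_regular l B \<longleftrightarrow>
             (\<exists>C. maxplus_mat C \<and> cond_C C \<and> strongly_normal C \<and> similar_mat l B C)))"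
proof (intro conjI ballI allI impI)
  fix l and B :: "nat mat"
  assume "l \<in> {l_infty, l_one, l_zero :: (nat \<Rightarrow> real) set}"
  then have "bounded_rearrangement_space l"
    using bounded_rearrangement_l_infty bounded_rearrangement_l_one
      bounded_rearrangement_l_zero by blast
  moreover assume "maxplus_mat B" "cond_C B"
  ultimately show "strongly_regular l B \<longleftrightarrow>
      (\<exists>C. maxplus_mat C \<and> cond_C C \<and> strongly_normal C \<and> similar_mat l B C)"
    by (rule strongly_regular_iff_similar_strongly_normal)
next
  fix l and B :: "int mat"
  assume "l \<in> {l_infty, l_one, l_zero :: (int \<Rightarrow> real) set}"
  then have "bounded_rearrangement_space l"
    using bounded_rearrangement_l_infty bounded_rearrangement_l_one
      bounded_rearrangement_l_zero by blast
  moreover assume "maxplus_mat B" "cond_C B"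
  ultimately show "strongly_regular l B \<longleftrightarrow>
      (\<exists>C. maxplus_mat C \<and> cond_C C \<and> strongly_normal C \<and> similar_mat l B C)"
    by (rule strongly_regular_iff_similar_strongly_normal)
qed

end
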